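(* Let $G$ be a complex unit hypergraph on $n$ vertices and let $S\subseteq V$ be nonempty and such that, for each $v\in S$, $\omega(v,e)$ takes the same value for all edges $e$ containing $v$. Then $$\lambda_1(K)\le\frac{\sum_{e\in E}|e\cap S|^2}{|S|}\le\lambda_n(K),$$ and, if every vertex has positive degree, $$\lambda_1(L)\le\frac{\sum_{e\in E}|e\cap S|^2}{\operatorname{vol}S}\le\lambda_n(L),$$ where $\operatorname{vol}S=\sum_{v\in S}\deg v$ and $e\cap S$ is the set of vertices of $S$ contained in $e$.
   Context: Let $\mathbb T=\{z\in\mathbb C:|z|=1\}$. A complex unit hypergraph $G=(V,E,\mathcal I,\omega)$ consists of finite sets $V=\{v_1,\dots,v_n\}$, $E$, an incidence set $\mathcal I\subseteq V\times E$ (write $v\in e$ if $(v,e)\in\mathcal I$), and $\omega:V\times E\to\mathbb T\cup\{0\}$ with $\omega(v,e)\ne0$ iff $v\in e$. For distinct $v_i,v_j$ in a common edge $e$, $\varphi_e(v_i,v_j)=-\omega(v_i,e)\omega(v_j,e)^{-1}$. $\deg v$ is the number of edges containing $v$; $D=\mathrm{diag}(\deg v_1,\dots,\deg v_n)$; $A=(a_{ij})$ with $a_{ij}=\sum_{e\ni v_i,v_j}\varphi_e(v_i,v_j)$ for $i\ne j$ with some edge containing both, $a_{ij}=0$ otherwise; $K=D-A$ (Hermitian), $L=D^{-1}K$ (real eigenvalues). $\lambda_1(M)$ and $\lambda_n(M)$ denote the smallest and largest eigenvalues. *)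

theory Defs
  imports "Jordan_Normal_Form.Spectral_Radius"
begin

text \<open>The vertices are kept as a list without repetitions, i.e. as the enumeration
  \<open>v\<^sub>1, \<dots>, v\<^sub>n\<close> that indexes the rows and columns of the matrices below
  (with indices starting at 0).\<close>

record ('v, 'e) hypergraph =
  vlist :: "'v list"
  edges :: "'e set"
  incid :: "('v \<times> 'e) set"
  omega :: "'v \<Rightarrow> 'e \<Rightarrow> complex"

definition verts :: "('v, 'e) hypergraph \<Rightarrow> 'v set" where
  "verts G = set (vlist G)"

locale complex_unit_hypergraph =
  fixes G :: "('v, 'e) hypergraph"
  assumes distinct_vlist: "distinct (vlist G)"
    and finite_edges: "finite (edges G)"
    and incid_subset: "incid G \<subseteq> verts G \<times> edges G"
    and omega_range:
      "\<And>v e. v \<in> verts G \<Longrightarrow> e \<in> edges G \<Longrightarrow> omega G v e \<in> {z. cmod z = 1} \<union> {0}"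
    and omega_nonzero_iff:
      "\<And>v e. v \<in> verts G \<Longrightarrow> e \<in> edges G \<Longrightarrow> omega G v e \<noteq> 0 \<longleftrightarrow> (v, e) \<in> incid G"

definition phi :: "('v, 'e) hypergraph \<Rightarrow> 'e \<Rightarrow> 'v \<Rightarrow> 'v \<Rightarrow> complex" where
  "phi G e u v = - omega G u e * inverse (omega G v e)"

definition vdeg :: "('v, 'e) hypergraph \<Rightarrow> 'v \<Rightarrow> nat" where
  "vdeg G v = card {e \<in> edges G. (v, e) \<in> incid G}"

definition vol :: "('v, 'e) hypergraph \<Rightarrow> 'v set \<Rightarrow> nat" where
  "vol G S = (\<Sum>v\<in>S. vdeg G v)"

definition edge_inter :: "('v, 'e) hypergraph \<Rightarrow> 'e \<Rightarrow> 'v set \<Rightarrow> 'v set" where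
  "edge_inter G e S = {v \<in> S. (v, e) \<in> incid G}"

definition degree_mat :: "('v, 'e) hypergraph \<Rightarrow> complex mat" where
  "degree_mat G = mat_diag (length (vlist G)) (\<lambda>i. of_nat (vdeg G (vlist G ! i)))"

text \<open>If no edge contains both vertices, the sum below is empty and the entry is 0.\<close>

definition adjacency_mat :: "('v, 'e) hypergraph \<Rightarrow> complex mat" where
  "adjacency_mat G = mat (length (vlist G)) (length (vlist G)) (\<lambda>(i, j).
     if i \<noteq> j then
       \<Sum>e \<in> {e \<in> edges G. (vlist G ! i, e) \<in> incid G \<and> (vlist G ! j, e) \<in> incid G}.
         phi G e (vlist G ! i) (vlist G ! j)
     else 0)"

definition kirchhoff_mat :: "('v, 'e) hypergraph \<Rightarrow> complex mat" where
  "kirchhoff_mat G = degree_mat G - adjacency_mat G"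

text \<open>The inverse of \<open>degree_mat G\<close> when all degrees are positive,
  see \<open>degree_mat_inverse\<close> below.\<close>

definition degree_inv_mat :: "('v, 'e) hypergraph \<Rightarrow> complex mat" where
  "degree_inv_mat G = mat_diag (length (vlist G)) (\<lambda>i. inverse (of_nat (vdeg G (vlist G ! i))))"

lemma degree_mat_inverse:
  assumes "\<forall>v \<in> verts G. vdeg G v > 0"
  shows "inverts_mat (degree_mat G) (degree_inv_mat G)"
    and "inverts_mat (degree_inv_mat G) (degree_mat G)"
proof -
  have nz: "(of_nat (vdeg G (vlist G ! i)) :: complex) \<noteq> 0" if "i < length (vlist G)" for i
  proof -
    have "vlist G ! i \<in> verts G" using that by (simp add: verts_def)
    then have "vdeg G (vlist G ! i) > 0" using assms by blast
    then show ?thesis by simp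
  qed
  show "inverts_mat (degree_mat G) (degree_inv_mat G)"
    and "inverts_mat (degree_inv_mat G) (degree_mat G)"
    unfolding inverts_mat_def degree_mat_def degree_inv_mat_def mat_diag_diag
    using nz by (auto simp: mat_diag_def intro!: eq_matI)
qed

definition laplacian_mat :: "('v, 'e) hypergraph \<Rightarrow> complex mat" where
  "laplacian_mat G = degree_inv_mat G * kirchhoff_mat G"

text \<open>Smallest and largest eigenvalue, for matrices of positive dimension (so that the spectrum
  is finite and nonempty) with real eigenvalues; \<open>Re\<close> only converts these real
  eigenvalues from type \<open>complex\<close> to type \<open>real\<close>.\<close>

definition min_eigenvalue :: "complex mat \<Rightarrow> real" where
  "min_eigenvalue M = Min (Re ` spectrum M)"

definition max_eigenvalue :: "complex mat \<Rightarrow> real" where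
  "max_eigenvalue M = Max (Re ` spectrum M)"

end

theory Submission
  imports Defs "HOL-Analysis.Function_Topology"
    "HOL-Analysis.Topology_Euclidean_Space"
begin

unbundle no vec_syntax

text \<open>Writing \<open>\<Omega>\<close> for the matrix of the \<open>\<omega>(v, e)\<close>, one has \<open>K = \<Omega> \<Omega>\<^sup>*\<close>, so that
  \<open>x\<^sup>* K x = (\<Sum>e. \<bar>\<Sum>v. x\<^sub>v\<^sup>* \<omega>(v, e)\<bar>\<^sup>2)\<close>. If \<open>x\<^sub>v\<close> is the common value of \<open>\<omega>(v, \<cdot>)\<close> for \<open>v \<in> S\<close> and
  \<open>0\<close> elsewhere, the inner sum counts \<open>e \<inter> S\<close>. The bounds are then those of a Rayleigh
  quotient, taken with respect to the weights \<open>1\<close> for \<open>K\<close> and \<open>deg v\<close> for \<open>L\<close>. The extreme values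
  of the quotient are attained by compactness; at such a point a semidefinite form
  vanishes, so the point lies in the kernel of that form, i.e. it is an eigenvector.\<close>

section \<open>Hermitian forms, weighted norms and Rayleigh quotients\<close>

definition qform :: "'i set \<Rightarrow> ('i \<Rightarrow> 'i \<Rightarrow> complex) \<Rightarrow> ('i \<Rightarrow> complex) \<Rightarrow> real" where
  "qform I H y = Re (\<Sum>i\<in>I. \<Sum>j\<in>I. cnj (y i) * H i j * y j)"

text \<open>The weights let one argument serve both matrices: \<open>L\<close> need not be
  Hermitian, but it is self-adjoint for the inner product weighted by the degrees, and its Rayleigh
  quotient there is the form of \<open>K\<close> divided by this norm.\<close>

definition wnorm2 :: "'i set \<Rightarrow> ('i \<Rightarrow> real) \<Rightarrow> ('i \<Rightarrow> complex) \<Rightarrow> real" where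
  "wnorm2 I w y = (\<Sum>i\<in>I. w i * (cmod (y i))\<^sup>2)"

lemma qform_scale: "qform I H (\<lambda>i. of_real t * y i) = t\<^sup>2 * qform I H y"
proof -
  have "(\<Sum>i\<in>I. \<Sum>j\<in>I. cnj (of_real t * y i) * H i j * (of_real t * y j))
      = of_real (t\<^sup>2) * (\<Sum>i\<in>I. \<Sum>j\<in>I. cnj (y i) * H i j * y j)"
    by (simp add: sum_distrib_left power2_eq_square mult_ac)
  then show ?thesis
    by (simp add: qform_def)
qed

lemma wnorm2_scale: "wnorm2 I w (\<lambda>i. of_real t * y i) = t\<^sup>2 * wnorm2 I w y"
  by (simp add: wnorm2_def norm_mult power_mult_distrib sum_distrib_left mult_ac)

lemma qform_cong: "(\<And>i. i \<in> I \<Longrightarrow> x i = y i) \<Longrightarrow> qform I H x = qform I H y"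
  by (simp add: qform_def)

lemma wnorm2_cong: "(\<And>i. i \<in> I \<Longrightarrow> x i = y i) \<Longrightarrow> wnorm2 I w x = wnorm2 I w y"
  by (simp add: wnorm2_def)

lemma qform_uminus: "qform I (\<lambda>i j. - H i j) y = - qform I H y"
  by (simp add: qform_def sum_negf)

lemma wnorm2_pos:
  assumes "finite I" "\<And>i. i \<in> I \<Longrightarrow> w i > 0" "k \<in> I" "y k \<noteq> 0"
  shows "wnorm2 I w y > 0"
  unfolding wnorm2_def
proof (rule sum_pos2[OF assms(1,3)])
  show "0 < w k * (cmod (y k))\<^sup>2"
    using assms by simp
  show "0 \<le> w i * (cmod (y i))\<^sup>2" if "i \<in> I" for i
    using assms(2)[OF that] by simp
qed

text \<open>A zero of a nonnegative form is a minimum, so the first variation vanishes there. Moving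
  from \<open>x\<close> in the direction \<open>M x\<close> has first variation twice the squared
  norm of \<open>M x\<close>, which forces \<open>M x = 0\<close>.\<close>

lemma semidefinite_kernel:
  assumes fin: "finite I"
    and herm: "\<And>i j. i \<in> I \<Longrightarrow> j \<in> I \<Longrightarrow> M j i = cnj (M i j)"
    and psd: "\<And>y. qform I M y \<ge> 0"
    and zero: "qform I M x = 0"
    and "i \<in> I"
  shows "(\<Sum>j\<in>I. M i j * x j) = 0"
proof -
  define g where "g i = (\<Sum>j\<in>I. M i j * x j)" for i
  define c where "c = (\<Sum>i\<in>I. (cmod (g i))\<^sup>2)"
  have gx: "(\<Sum>i\<in>I. \<Sum>j\<in>I. cnj (g i) * M i j * x j) = of_real c"
  proof -
    have "(\<Sum>i\<in>I. \<Sum>j\<in>I. cnj (g i) * M i j * x j) = (\<Sum>i\<in>I. cnj (g i) * g i)"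
      by (simp add: g_def sum_distrib_left mult.assoc)
    also have "\<dots> = of_real c"
      by (simp add: c_def complex_norm_square mult.commute del: of_real_power)
    finally show ?thesis .
  qed
  \<comment> \<open>Hermitian symmetry makes the two mixed terms conjugate to each other; as
    \<open>c\<close> is real, both equal \<open>c\<close>.\<close>
  have swap: "cnj (x i) * M i j * g j = cnj (cnj (g j) * M j i * x i)" if "i \<in> I" "j \<in> I" for i j
    using herm[OF that] by simp
  have "(\<Sum>i\<in>I. \<Sum>j\<in>I. cnj (x i) * M i j * g j) = (\<Sum>j\<in>I. \<Sum>i\<in>I. cnj (x i) * M i j * g j)"
    by (rule sum.swap)
  also have "\<dots> = cnj (\<Sum>j\<in>I. \<Sum>i\<in>I. cnj (g j) * M j i * x i)"
    by (simp only: cnj_sum swap cong: sum.cong)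
  finally have xg: "(\<Sum>i\<in>I. \<Sum>j\<in>I. cnj (x i) * M i j * g j) = of_real c"
    by (simp only: gx complex_cnj_complex_of_real)
  have expand: "qform I M (\<lambda>i. x i + of_real s * g i) = 2 * s * c + s\<^sup>2 * qform I M g" for s :: real
  proof -
    have "(\<Sum>i\<in>I. \<Sum>j\<in>I. cnj (x i + of_real s * g i) * M i j * (x j + of_real s * g j))
        = (\<Sum>i\<in>I. \<Sum>j\<in>I. cnj (x i) * M i j * x j)
          + of_real s * (\<Sum>i\<in>I. \<Sum>j\<in>I. cnj (x i) * M i j * g j)
          + of_real s * (\<Sum>i\<in>I. \<Sum>j\<in>I. cnj (g i) * M i j * x j)
          + of_real (s\<^sup>2) * (\<Sum>i\<in>I. \<Sum>j\<in>I. cnj (g i) * M i j * g j)"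
      unfolding sum_distrib_left sum.distrib[symmetric]
      by (intro sum.cong refl) (simp add: algebra_simps power2_eq_square)
    then show ?thesis
      using zero unfolding gx xg qform_def by simp
  qed
  define b where "b = qform I M g"
  have "b \<ge> 0" "c \<ge> 0"
    using psd by (auto simp: b_def c_def intro: sum_nonneg)
  \<comment> \<open>The parameter \<open>s = - t\<close> makes the linear term outweigh the
    quadratic one. The summand 1 keeps the denominator positive when \<open>b = 0\<close>.\<close>
  define t where "t = c / (b + 1)"
  have c: "c = t * (b + 1)"
    using \<open>b \<ge> 0\<close> by (simp add: t_def)
  have "0 \<le> 2 * (- t) * c + (- t)\<^sup>2 * b"
    using psd expand unfolding b_def by metis
  also have "\<dots> = - (t\<^sup>2 * (b + 2))"
    by (simp add: c algebra_simps power2_eq_square)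
  finally have "t\<^sup>2 * (b + 2) \<le> 0"
    by simp
  then have "c = 0"
    using \<open>b \<ge> 0\<close> by (simp add: c mult_le_0_iff)
  then have "g i = 0"
    using fin \<open>i \<in> I\<close> by (simp add: c_def sum_nonneg_eq_0_iff)
  then show ?thesis
    by (simp add: g_def)
qed

text \<open>Let \<open>W\<close> be the diagonal matrix of the weights and \<mu> the maximum of the
  form on the weighted unit sphere, attained at \<open>x\<close>. Then \<open>\<mu> W - H\<close> is
  positive semidefinite and its form vanishes at \<open>x\<close>, so
  \<open>H x = \<mu> W x\<close>.\<close>

lemma weighted_rayleigh_max:
  assumes fin: "finite I" and ne: "I \<noteq> {}"
    and w: "\<And>i. i \<in> I \<Longrightarrow> w i > 0"
    and herm: "\<And>i j. i \<in> I \<Longrightarrow> j \<in> I \<Longrightarrow> H j i = cnj (H i j)"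
  shows "\<exists>x \<mu> :: real. (\<exists>i\<in>I. x i \<noteq> 0)
    \<and> (\<forall>i\<in>I. (\<Sum>j\<in>I. H i j * x j) = of_real (\<mu> * w i) * x i)
    \<and> (\<forall>y. qform I H y \<le> \<mu> * wnorm2 I w y)"
proof -
  \<comment> \<open>Vectors are functions on the whole index type, so compactness comes from
    Tychonoff's theorem: coordinates outside \<open>I\<close> are pinned to 0, and the radii inside
    \<open>I\<close> are those that weighted norm 1 imposes.\<close>
  define P where "P = PiE UNIV (\<lambda>i. if i \<in> I then cball 0 (sqrt (1 / w i)) else {0 :: complex})"
  have "compact P"
    unfolding P_def compactin_euclidean_iff[symmetric] euclidean_product_topology[symmetric] compactin_PiE
    by auto
  moreover have "closed {y. wnorm2 I w y = 1}"
    unfolding wnorm2_def by (intro closed_Collect_eq continuous_intros) auto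
  ultimately have compact: "compact (P \<inter> {y. wnorm2 I w y = 1})"
    by blast
  have P_I: "y \<in> P" if "wnorm2 I w y = 1" "\<And>i. i \<notin> I \<Longrightarrow> y i = 0" for y
  proof -
    have "cmod (y i) \<le> sqrt (1 / w i)" if "i \<in> I" for i
    proof (rule real_le_rsqrt)
      have "w i * (cmod (y i))\<^sup>2 \<le> wnorm2 I w y"
        unfolding wnorm2_def using fin w that
        by (intro member_le_sum[where f = "\<lambda>i. w i * (cmod (y i))\<^sup>2"]) (auto simp: less_imp_le)
      then show "(cmod (y i))\<^sup>2 \<le> 1 / w i"
        using \<open>wnorm2 I w y = 1\<close> w[OF that] by (simp add: field_simps)
    qed
    then show ?thesis
      using that(2) by (auto simp: P_def)
  qed
  \<comment> \<open>Besides rescaling, the coordinates outside \<open>I\<close> are set to 0 so that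
    the vector lands in \<open>P\<close>; neither form sees them.\<close>
  have normalize: "\<exists>z. z \<in> P \<and> wnorm2 I w z = 1 \<and> qform I H z = qform I H y / wnorm2 I w y"
    if pos: "wnorm2 I w y > 0" for y
  proof -
    define t where "t = 1 / sqrt (wnorm2 I w y)"
    have t2: "t\<^sup>2 = 1 / wnorm2 I w y"
      using pos by (simp add: t_def power_divide)
    define z where "z i = (if i \<in> I then of_real t * y i else 0)" for i
    have "wnorm2 I w z = wnorm2 I w (\<lambda>i. of_real t * y i)"
      by (rule wnorm2_cong) (simp add: z_def)
    then have 1: "wnorm2 I w z = 1"
      using pos t2 by (simp add: wnorm2_scale)
    have "qform I H z = qform I H (\<lambda>i. of_real t * y i)"
      by (rule qform_cong) (simp add: z_def)
    then have "qform I H z = qform I H y / wnorm2 I w y"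
      using t2 by (simp add: qform_scale)
    moreover have "z \<in> P"
      by (rule P_I[OF 1]) (simp add: z_def)
    ultimately show ?thesis
      using 1 by blast
  qed
  from ne obtain k where "k \<in> I"
    by blast
  then have "wnorm2 I w (\<lambda>_. 1) > 0"
    using fin w by (intro wnorm2_pos) auto
  from normalize[OF this] have "P \<inter> {y. wnorm2 I w y = 1} \<noteq> {}"
    by blast
  moreover have "continuous_on (P \<inter> {y. wnorm2 I w y = 1}) (qform I H)"
    unfolding qform_def
    by (intro continuous_intros continuous_on_subset[OF continuous_on_product_coordinates]) auto
  ultimately obtain x where x: "wnorm2 I w x = 1"
    and max: "\<And>y. y \<in> P \<Longrightarrow> wnorm2 I w y = 1 \<Longrightarrow> qform I H y \<le> qform I H x"
    using continuous_attains_sup[OF compact] by blast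
  define \<mu> where "\<mu> = qform I H x"
  \<comment> \<open>Homogeneity carries the bound from the unit sphere to every \<open>y\<close>; if
    \<open>y\<close> vanishes on \<open>I\<close>, both sides are 0.\<close>
  have bound: "qform I H y \<le> \<mu> * wnorm2 I w y" for y
  proof (cases "\<exists>k\<in>I. y k \<noteq> 0")
    case True
    then have pos: "wnorm2 I w y > 0"
      using fin w wnorm2_pos by metis
    from normalize[OF this] max have "qform I H y / wnorm2 I w y \<le> \<mu>"
      unfolding \<mu>_def by metis
    then show ?thesis
      using pos by (simp add: field_simps)
  next
    case False
    then show ?thesis
      by (simp add: qform_def wnorm2_def)
  qed
  define M where "M i j = (if i = j then of_real (\<mu> * w i) else 0) - H i j" for i j
  have Mx: "(\<Sum>j\<in>I. M i j * y j) = of_real (\<mu> * w i) * y i - (\<Sum>j\<in>I. H i j * y j)"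
    if "i \<in> I" for i y
  proof -
    have "(\<Sum>j\<in>I. M i j * y j)
        = (\<Sum>j\<in>I. (if i = j then of_real (\<mu> * w i) * y j else 0) - H i j * y j)"
      by (rule sum.cong) (auto simp: M_def algebra_simps)
    then show ?thesis
      using that fin by (simp add: sum_subtractf)
  qed
  have M: "qform I M y = \<mu> * wnorm2 I w y - qform I H y" for y
  proof -
    have "(\<Sum>i\<in>I. \<Sum>j\<in>I. cnj (y i) * M i j * y j) = (\<Sum>i\<in>I. cnj (y i) * (\<Sum>j\<in>I. M i j * y j))"
      by (simp add: sum_distrib_left mult.assoc)
    also have "\<dots> = (\<Sum>i\<in>I. of_real (\<mu> * (w i * (cmod (y i))\<^sup>2)) - (\<Sum>j\<in>I. cnj (y i) * H i j * y j))"
      by (rule sum.cong)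
        (simp_all add: Mx right_diff_distrib sum_distrib_left mult.assoc complex_norm_square
          mult.left_commute mult.commute[of "cnj _"] del: of_real_power)
    also have "\<dots> = of_real (\<mu> * wnorm2 I w y) - (\<Sum>i\<in>I. \<Sum>j\<in>I. cnj (y i) * H i j * y j)"
      by (simp add: sum_subtractf wnorm2_def sum_distrib_left)
    finally show ?thesis
      by (simp add: qform_def)
  qed
  have "(\<Sum>j\<in>I. M i j * x j) = 0" if "i \<in> I" for i
    using that
  proof (rule semidefinite_kernel[OF fin, rotated -1])
    show "M j i = cnj (M i j)" if "i \<in> I" "j \<in> I" for i j
      using herm[OF that] by (simp add: M_def)
    show "qform I M y \<ge> 0" for y
      using bound[of y] by (simp add: M)
    show "qform I M x = 0"
      using x by (simp add: M \<mu>_def)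
  qed
  then have "(\<Sum>j\<in>I. H i j * x j) = of_real (\<mu> * w i) * x i" if "i \<in> I" for i
    using Mx[OF that, of x] that by simp
  moreover have "\<exists>i\<in>I. x i \<noteq> 0"
    using x by (auto simp: wnorm2_def intro: ccontr)
  ultimately show ?thesis
    using bound by blast
qed

text \<open>Here \<open>A\<close> is \<open>H\<close> with row \<open>i\<close> divided by its
  weight, so dividing the generalized equation \<open>H x = \<mu> W x\<close> by the weights gives
  an ordinary eigenvector of \<open>A\<close>, namely \<open>x\<close> listed in the order of
  \<open>vs\<close>.\<close>

lemma spectrum_weightedI:
  fixes H :: "'i \<Rightarrow> 'i \<Rightarrow> complex" and w :: "'i \<Rightarrow> real"
  assumes "distinct vs" and A: "A \<in> carrier_mat (length vs) (length vs)"
    and w: "\<And>i. i \<in> set vs \<Longrightarrow> w i > 0"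
    and entries: "\<And>i j. i < length vs \<Longrightarrow> j < length vs
      \<Longrightarrow> A $$ (i, j) = H (vs ! i) (vs ! j) / of_real (w (vs ! i))"
    and nz: "\<exists>i\<in>set vs. x i \<noteq> 0"
    and eig: "\<forall>i\<in>set vs. (\<Sum>j\<in>set vs. H i j * x j) = of_real (\<mu> * w i) * x i"
  shows "of_real \<mu> \<in> spectrum A"
proof -
  define n where "n = length vs"
  define y where "y = Matrix.vec n (\<lambda>i. x (vs ! i))"
  have "A *\<^sub>v y = of_real \<mu> \<cdot>\<^sub>v y"
  proof (rule eq_vecI)
    fix i assume "i < dim_vec (of_real \<mu> \<cdot>\<^sub>v y)"
    then have i: "i < n"
      by (simp add: y_def)
    then have vi: "vs ! i \<in> set vs"
      by (simp add: n_def)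
    have "(A *\<^sub>v y) $ i = (\<Sum>j<n. H (vs ! i) (vs ! j) * x (vs ! j)) / of_real (w (vs ! i))"
      using A i entries
      by (auto simp: y_def n_def scalar_prod_def atLeast0LessThan sum_divide_distrib intro!: sum.cong)
    also have "(\<Sum>j<n. H (vs ! i) (vs ! j) * x (vs ! j)) = (\<Sum>v\<in>set vs. H (vs ! i) v * x v)"
      by (rule sum.reindex_bij_betw[OF bij_betw_nth]) (use \<open>distinct vs\<close> in \<open>auto simp: n_def\<close>)
    also have "\<dots> = of_real (\<mu> * w (vs ! i)) * x (vs ! i)"
      using eig vi by blast
    finally show "(A *\<^sub>v y) $ i = (of_real \<mu> \<cdot>\<^sub>v y) $ i"
      using i w[OF vi] by (simp add: y_def)
  qed (use A in \<open>simp add: y_def n_def\<close>)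
  moreover have "y \<noteq> 0\<^sub>v n"
  proof
    assume y0: "y = 0\<^sub>v n"
    from nz obtain i where "i < n" "x (vs ! i) \<noteq> 0"
      by (auto simp: in_set_conv_nth n_def)
    then show False
      using arg_cong[OF y0, of "\<lambda>v. v $ i"] by (simp add: y_def)
  qed
  ultimately show ?thesis
    using A unfolding spectrum_def eigenvalue_def eigenvector_def
    by (auto simp: n_def y_def intro!: exI[of _ y])
qed

lemma weighted_rayleigh_bounds:
  fixes w :: "'i \<Rightarrow> real"
  assumes vs: "distinct vs" and A: "A \<in> carrier_mat (length vs) (length vs)"
    and w: "\<And>i. i \<in> set vs \<Longrightarrow> w i > 0"
    and entries: "\<And>i j. i < length vs \<Longrightarrow> j < length vs
      \<Longrightarrow> A $$ (i, j) = H (vs ! i) (vs ! j) / of_real (w (vs ! i))"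
    and herm: "\<And>i j. i \<in> set vs \<Longrightarrow> j \<in> set vs \<Longrightarrow> H j i = cnj (H i j)"
    and y: "\<exists>i\<in>set vs. y i \<noteq> 0"
  shows "min_eigenvalue A \<le> qform (set vs) H y / wnorm2 (set vs) w y"
    and "qform (set vs) H y / wnorm2 (set vs) w y \<le> max_eigenvalue A"
proof -
  \<comment> \<open>Finiteness is what makes \<open>Min\<close> and \<open>Max\<close> bound every
    member of the spectrum.\<close>
  have fin: "finite (Re ` spectrum A)"
    using card_finite_spectrum(1)[OF A] by simp
  have ne: "set vs \<noteq> {}"
    using y by auto
  have pos: "wnorm2 (set vs) w y > 0"
    using y w wnorm2_pos[of "set vs"] by blast
  obtain x \<mu> where x: "\<exists>i\<in>set vs. x i \<noteq> 0"
    "\<forall>i\<in>set vs. (\<Sum>j\<in>set vs. H i j * x j) = of_real (\<mu> * w i) * x i"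
    and le: "\<forall>y. qform (set vs) H y \<le> \<mu> * wnorm2 (set vs) w y"
    using weighted_rayleigh_max[where w = w and H = H, OF finite_set ne w herm] by blast
  have "of_real \<mu> \<in> spectrum A"
    by (rule spectrum_weightedI[OF vs A w entries x])
  then have "\<mu> \<in> Re ` spectrum A"
    by force
  then have "\<mu> \<le> max_eigenvalue A"
    using fin by (simp add: max_eigenvalue_def)
  moreover have "qform (set vs) H y / wnorm2 (set vs) w y \<le> \<mu>"
    using pos le[THEN spec, of y] by (simp add: field_simps)
  ultimately show "qform (set vs) H y / wnorm2 (set vs) w y \<le> max_eigenvalue A"
    by simp
  have herm': "- H j i = cnj (- H i j)" if "i \<in> set vs" "j \<in> set vs" for i j
    using herm[OF that] by simp
  \<comment> \<open>The lower bound is the upper bound for \<open>- H\<close>: the maximum \<nu> of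
    the negated quotient yields the eigenvalue \<open>- \<nu>\<close> of \<open>A\<close>.\<close>
  obtain z \<nu> where z: "\<exists>i\<in>set vs. z i \<noteq> 0"
    "\<forall>i\<in>set vs. (\<Sum>j\<in>set vs. - H i j * z j) = of_real (\<nu> * w i) * z i"
    and le': "\<forall>y. qform (set vs) (\<lambda>i j. - H i j) y \<le> \<nu> * wnorm2 (set vs) w y"
    using weighted_rayleigh_max[where w = w and H = "\<lambda>i j. - H i j", OF finite_set ne w herm']
    by blast
  have "\<forall>i\<in>set vs. (\<Sum>j\<in>set vs. H i j * z j) = of_real (- \<nu> * w i) * z i"
    using z(2) by (simp add: sum_negf minus_equation_iff[of "sum _ _"])
  from spectrum_weightedI[OF vs A w entries z(1) this] have "of_real (- \<nu>) \<in> spectrum A" .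
  then have "- \<nu> \<in> Re ` spectrum A"
    by force
  then have "min_eigenvalue A \<le> - \<nu>"
    using fin by (simp add: min_eigenvalue_def)
  moreover have "- \<nu> \<le> qform (set vs) H y / wnorm2 (set vs) w y"
    using pos le'[THEN spec, of y] by (simp add: qform_uminus field_simps)
  ultimately show "min_eigenvalue A \<le> qform (set vs) H y / wnorm2 (set vs) w y"
    by simp
qed

text \<open>The form of \<open>B B\<^sup>*\<close> at \<open>y\<close> is the squared norm of
  \<open>B\<^sup>* y\<close>; the sums inside the modulus are the conjugates of its entries.\<close>

lemma qform_gram:
  assumes "finite I"
  shows "qform I (\<lambda>u v. \<Sum>e\<in>E. B u e * cnj (B v e)) y
    = (\<Sum>e\<in>E. (cmod (\<Sum>u\<in>I. cnj (y u) * B u e))\<^sup>2)"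
proof -
  have "(\<Sum>u\<in>I. \<Sum>v\<in>I. cnj (y u) * (\<Sum>e\<in>E. B u e * cnj (B v e)) * y v)
      = (\<Sum>u\<in>I. \<Sum>v\<in>I. \<Sum>e\<in>E. (cnj (y u) * B u e) * cnj (cnj (y v) * B v e))"
    by (simp add: sum_distrib_left sum_distrib_right mult_ac)
  also have "\<dots> = (\<Sum>u\<in>I. \<Sum>e\<in>E. \<Sum>v\<in>I. (cnj (y u) * B u e) * cnj (cnj (y v) * B v e))"
    by (intro sum.cong refl sum.swap)
  also have "\<dots> = (\<Sum>e\<in>E. \<Sum>u\<in>I. \<Sum>v\<in>I. (cnj (y u) * B u e) * cnj (cnj (y v) * B v e))"
    by (rule sum.swap)
  also have "\<dots> = (\<Sum>e\<in>E. (\<Sum>u\<in>I. cnj (y u) * B u e) * cnj (\<Sum>u\<in>I. cnj (y u) * B u e))"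
    by (simp only: sum_product cnj_sum)
  also have "\<dots> = of_real (\<Sum>e\<in>E. (cmod (\<Sum>u\<in>I. cnj (y u) * B u e))\<^sup>2)"
    by (simp only: of_real_sum complex_norm_square)
  finally show ?thesis
    by (simp only: qform_def Re_complex_of_real)
qed

section \<open>The Kirchhoff matrix as a Gram matrix, and the test vector of
  \<open>S\<close>\<close>

context complex_unit_hypergraph
begin

lemma cmod_omega:
  assumes "v \<in> verts G" "e \<in> edges G"
  shows "cmod (omega G v e) = (if (v, e) \<in> incid G then 1 else 0)"
  using omega_range[OF assms] omega_nonzero_iff[OF assms] by auto

lemma kirchhoff_mat_carrier:
  "kirchhoff_mat G \<in> carrier_mat (length (vlist G)) (length (vlist G))"
  by (auto simp: kirchhoff_mat_def adjacency_mat_def intro!: minus_carrier_mat)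

text \<open>On the diagonal each incident edge contributes a squared modulus 1, which adds up to the
  degree. Off the diagonal the inverse in \<open>phi\<close> is a conjugate, by unit modulus, and
  its minus sign cancels that of \<open>D - A\<close>.\<close>

lemma kirchhoff_mat_entry:
  assumes "i < length (vlist G)" "j < length (vlist G)"
  shows "kirchhoff_mat G $$ (i, j)
    = (\<Sum>e\<in>edges G. omega G (vlist G ! i) e * cnj (omega G (vlist G ! j) e))"
proof -
  let ?u = "vlist G ! i" and ?v = "vlist G ! j"
  have u: "?u \<in> verts G" and v: "?v \<in> verts G"
    using assms by (auto simp: verts_def)
  show ?thesis
  proof (cases "i = j")
    case True
    have "(\<Sum>e\<in>edges G. omega G ?u e * cnj (omega G ?u e))
        = (\<Sum>e\<in>edges G. if (?u, e) \<in> incid G then 1 else 0)"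
      by (rule sum.cong) (use u in \<open>auto simp: complex_norm_square[symmetric] cmod_omega\<close>)
    also have "\<dots> = of_nat (vdeg G ?u)"
      using finite_edges by (simp add: vdeg_def sum.If_cases Int_def conj_commute)
    finally show ?thesis
      using True assms by (simp add: kirchhoff_mat_def degree_mat_def adjacency_mat_def mat_diag_def)
  next
    case False
    let ?F = "{e \<in> edges G. (?u, e) \<in> incid G \<and> (?v, e) \<in> incid G}"
    have "- phi G e ?u ?v = omega G ?u e * cnj (omega G ?v e)" if "e \<in> ?F" for e
    proof -
      have "cmod (omega G ?v e) = 1"
        using that cmod_omega v by auto
      then show ?thesis
        using complex_norm_square[of "omega G ?v e"] inverse_unique[of "omega G ?v e" "cnj (omega G ?v e)"]
      by (simp add: phi_def)
    qed
    then have "(\<Sum>e\<in>?F. - phi G e ?u ?v) = (\<Sum>e\<in>?F. omega G ?u e * cnj (omega G ?v e))"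
      by (rule sum.cong[OF refl])
    \<comment> \<open>An edge missing one of the two vertices adds 0, since \<open>omega\<close>
      vanishes there.\<close>
    also have "\<dots> = (\<Sum>e\<in>edges G. omega G ?u e * cnj (omega G ?v e))"
      using finite_edges omega_nonzero_iff u v by (intro sum.mono_neutral_left) auto
    finally show ?thesis
      using False assms
      by (simp add: kirchhoff_mat_def degree_mat_def adjacency_mat_def mat_diag_def sum_negf)
  qed
qed

lemma laplacian_mat_entry:
  assumes "i < length (vlist G)" "j < length (vlist G)"
  shows "laplacian_mat G $$ (i, j) = kirchhoff_mat G $$ (i, j) / of_nat (vdeg G (vlist G ! i))"
  using assms kirchhoff_mat_carrier unfolding laplacian_mat_def degree_inv_mat_def
  by (simp add: mat_diag_mult_left[of _ _ "length (vlist G)"] divide_inverse mult.commute)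

text \<open>The value \<open>1\<close> is chosen at isolated vertices of \<open>S\<close>.\<close>

lemma constant_phase_vector:
  assumes S: "S \<subseteq> verts G"
    and const: "\<forall>v\<in>S. \<exists>c. \<forall>e\<in>edges G. (v, e) \<in> incid G \<longrightarrow> omega G v e = c"
  obtains y where "\<And>v. v \<in> S \<Longrightarrow> cmod (y v) = 1" and "\<And>v. v \<notin> S \<Longrightarrow> y v = 0"
    and "\<And>e. e \<in> edges G \<Longrightarrow>
      (\<Sum>v\<in>verts G. cnj (y v) * omega G v e) = of_nat (card (edge_inter G e S))"
proof -
  have "\<exists>c. cmod c = 1 \<and> (\<forall>e\<in>edges G. (v, e) \<in> incid G \<longrightarrow> omega G v e = c)" if "v \<in> S" for v
  proof (cases "\<exists>e\<in>edges G. (v, e) \<in> incid G")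
    case True
    then show ?thesis
      using const S that cmod_omega by (metis subsetD)
  next
    case False
    then show ?thesis
      by (intro exI[of _ 1]) auto
  qed
  then obtain c where c: "\<And>v. v \<in> S \<Longrightarrow> cmod (c v) = 1"
    "\<And>v e. v \<in> S \<Longrightarrow> e \<in> edges G \<Longrightarrow> (v, e) \<in> incid G \<Longrightarrow> omega G v e = c v"
    by metis
  define y where "y v = (if v \<in> S then c v else 0)" for v
  have "(\<Sum>v\<in>verts G. cnj (y v) * omega G v e) = of_nat (card (edge_inter G e S))"
    if e: "e \<in> edges G" for e
  proof -
    \<comment> \<open>On \<open>edge_inter G e S\<close> the product is a squared modulus 1.
      Elsewhere one factor is 0: \<open>y\<close> off \<open>S\<close>, \<open>omega\<close> off the
      edge.\<close>
    have "cnj (y v) * omega G v e = (if v \<in> edge_inter G e S then 1 else 0)" if "v \<in> verts G" for v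
    proof (cases "v \<in> edge_inter G e S")
      case True
      then have "y v = omega G v e" "cmod (omega G v e) = 1"
        using c e that by (auto simp: edge_inter_def y_def cmod_omega)
      then show ?thesis
        using True complex_norm_square[of "omega G v e"] by (simp add: mult.commute)
    next
      case False
      then show ?thesis
        using omega_nonzero_iff[OF that e] by (auto simp: edge_inter_def y_def)
    qed
    then have "(\<Sum>v\<in>verts G. cnj (y v) * omega G v e)
        = (\<Sum>v\<in>verts G. if v \<in> edge_inter G e S then 1 else 0)"
      by (rule sum.cong[OF refl])
    also have "\<dots> = of_nat (card (verts G \<inter> edge_inter G e S))"
      by (simp add: sum.If_cases verts_def)
    also have "verts G \<inter> edge_inter G e S = edge_inter G e S"
      using S by (auto simp: edge_inter_def)
    finally show ?thesis .
  qed
  then show ?thesis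
    using that[of y] c by (simp add: y_def)
qed

end

theorem theorem5p10:
  fixes G :: "('v, 'e) hypergraph" and S :: "'v set"
  assumes "complex_unit_hypergraph G"
    and "S \<subseteq> verts G" and "S \<noteq> {}"
    and "\<forall>v\<in>S. \<exists>c. \<forall>e\<in>edges G. (v, e) \<in> incid G \<longrightarrow> omega G v e = c"
  shows "(min_eigenvalue (kirchhoff_mat G)
            \<le> (\<Sum>e\<in>edges G. (real (card (edge_inter G e S)))\<^sup>2) / real (card S)
          \<and> (\<Sum>e\<in>edges G. (real (card (edge_inter G e S)))\<^sup>2) / real (card S)
            \<le> max_eigenvalue (kirchhoff_mat G))
       \<and> ((\<forall>v\<in>verts G. vdeg G v > 0) \<longrightarrow>
            min_eigenvalue (laplacian_mat G)
              \<le> (\<Sum>e\<in>edges G. (real (card (edge_inter G e S)))\<^sup>2) / real (vol G S)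
          \<and> (\<Sum>e\<in>edges G. (real (card (edge_inter G e S)))\<^sup>2) / real (vol G S)
              \<le> max_eigenvalue (laplacian_mat G))"
proof -
  interpret complex_unit_hypergraph G by fact
  define H where "H u v = (\<Sum>e\<in>edges G. omega G u e * cnj (omega G v e))" for u v
  have herm: "H v u = cnj (H u v)" for u v
    by (simp add: H_def mult.commute)
  obtain y where y1: "\<And>v. v \<in> S \<Longrightarrow> cmod (y v) = 1" and y0: "\<And>v. v \<notin> S \<Longrightarrow> y v = 0"
    and yo: "\<And>e. e \<in> edges G \<Longrightarrow>
      (\<Sum>v\<in>verts G. cnj (y v) * omega G v e) = of_nat (card (edge_inter G e S))"
    using constant_phase_vector[OF assms(2,4)] by blast
  have q: "qform (set (vlist G)) H y = (\<Sum>e\<in>edges G. (real (card (edge_inter G e S)))\<^sup>2)"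
    unfolding H_def qform_gram[OF finite_set] using yo by (simp add: verts_def)
  \<comment> \<open>The weights stay arbitrary because both denominators come from here: weight 1
    gives \<open>card S\<close>, the degrees give \<open>vol G S\<close>.\<close>
  have N: "wnorm2 (set (vlist G)) w y = (\<Sum>v\<in>S. w v)" for w
  proof -
    have "wnorm2 (set (vlist G)) w y = (\<Sum>v\<in>S. w v * (cmod (y v))\<^sup>2)"
      unfolding wnorm2_def using assms(2) y0
      by (intro sum.mono_neutral_right) (auto simp: verts_def)
    then show ?thesis
      using y1 by simp
  qed
  have nz: "\<exists>v\<in>set (vlist G). y v \<noteq> 0"
    using assms(2,3) y1 by (force simp: verts_def)
  have K: "kirchhoff_mat G $$ (i, j) = H (vlist G ! i) (vlist G ! j)"
    if "i < length (vlist G)" "j < length (vlist G)" for i j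
    using kirchhoff_mat_entry[OF that] by (simp add: H_def)
  note Kbounds = weighted_rayleigh_bounds[where w = "\<lambda>_. 1" and H = H and y = y,
      OF distinct_vlist kirchhoff_mat_carrier _ _ herm nz]
  \<comment> \<open>The form \<open>H\<close> and the vector \<open>y\<close> are those used for
    \<open>K\<close>; only the weights change. Their positivity is the assumption on the
    degrees.\<close>
  note Lbounds = weighted_rayleigh_bounds[where w = "\<lambda>v. real (vdeg G v)" and H = H and y = y
        and A = "laplacian_mat G", OF distinct_vlist _ _ _ herm nz]
  have L: "laplacian_mat G \<in> carrier_mat (length (vlist G)) (length (vlist G))"
    unfolding laplacian_mat_def degree_inv_mat_def
    by (rule mult_carrier_mat[OF mat_diag_dim kirchhoff_mat_carrier])
  have vol: "real (vol G S) = (\<Sum>v\<in>S. real (vdeg G v))"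
    by (simp add: vol_def)
  show ?thesis
    using Kbounds Lbounds[OF L] by (simp add: K laplacian_mat_entry q N vol verts_def)
qed

end
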